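(* Let $n\ge 3$ and $K>0$. Let $\varphi$ be a solution to the ODE $$K\varphi^{n-2}=-\varphi''(1-\varphi'^2)^{\frac{n-3}{2}},$$ with integration constant $C_K$. Then: (1) The inverse function of $\varphi$ is given by $$t-t_0=\int_{\varphi(t_0)}^{\varphi(t)}\pm\frac{d\varphi}{\sqrt{1-(K\varphi^{n-1}-C_K)^{\frac{2}{n-1}}}},$$ where $t_0$ is a fixed initial time. (2) The solution $\varphi$ can be defined on the interval $I=[C',C'+T]$, where $C'$ is a real number, $$T=T(C_K)=2\int_{\left(\max\{0,\frac{C_K}{K}\}\right)^{\frac{1}{n-1}}}^{\left(\frac{C_K+1}{K}\right)^{\frac{1}{n-1}}}\frac{d\varphi}{\sqrt{1-(K\varphi^{n-1}-C_K)^{\frac{2}{n-1}}}},$$ and $\varphi(C')=\varphi(C'+T)=\left(\max\{0,\frac{C_K}{K}\}\right)^{\frac{1}{n-1}}$. (3) The sign of the integrand in (1) is $+$ for $t\in[C',C'+\frac{T}{2}]$ and $-$ for $t\in[C'+\frac{T}{2},C'+T]$, or the other way around if the orientation of the generating curve is reversed.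
   Context: Here $\varphi$ is the radius function of the arclength-parametrized generating curve $(\varphi(t),\psi(t))$ of a rotational hypersurface in $\mathbb{R}^n$ with $\varphi'^2+\psi'^2=1$ and $\psi'\ge0$; in particular $|\varphi'|\le 1$, $\varphi\ge 0$, and $\varphi$ is not identically zero. The ODE expresses that the hypersurface has constant Gauss-Kronecker curvature $K$. The real constant $C_K$ is the integration constant of the first integral $K\varphi^{n-1}=(1-\varphi'^2)^{\frac{n-1}{2}}+C_K$ (for $K>0$ one has $C_K>-1$). The sign $\pm$ in the integrand agrees with the sign of $\varphi'$ (the integral is taken piecewise along the curve when $\varphi'$ changes sign). Being a solution on a closed interval means being continuous on it and satisfying the ODE in its interior. *)

theory Defs
  imports "HOL-Analysis.Analysis"
begin

definition radius_function :: "(real \<Rightarrow> real) \<Rightarrow> real set \<Rightarrow> bool" where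
  "radius_function \<phi> J \<longleftrightarrow>
     continuous_on J \<phi> \<and> (\<forall>t\<in>J. 0 \<le> \<phi> t) \<and> (\<exists>t\<in>J. \<phi> t \<noteq> 0) \<and>
     (\<exists>\<psi>. continuous_on J \<psi> \<and>
        (\<forall>t\<in>interior J. \<phi> differentiable at t \<and> \<psi> differentiable at t \<and>
           (deriv \<phi> t)\<^sup>2 + (deriv \<psi> t)\<^sup>2 = 1 \<and> 0 \<le> deriv \<psi> t))"

text \<open>
  Half-integer powers \<open>(1 - \<phi>'\<^sup>2)\<close> to the \<open>k/2\<close> are written \<open>sqrt (1 - \<phi>'\<^sup>2) ^ k\<close>: the base is
  nonnegative, and unlike \<open>powr\<close> (where \<open>0 powr 0 = 0\<close>) this gives the exponent \<open>0\<close>, which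
  occurs for \<open>n = 3\<close>, its usual meaning.
\<close>

definition ode_solution :: "nat \<Rightarrow> real \<Rightarrow> (real \<Rightarrow> real) \<Rightarrow> real set \<Rightarrow> bool" where
  "ode_solution n K \<phi> J \<longleftrightarrow>
     continuous_on J \<phi> \<and>
     (\<forall>t\<in>interior J. \<phi> differentiable at t \<and> deriv \<phi> differentiable at t \<and>
        K * \<phi> t ^ (n - 2) = - deriv (deriv \<phi>) t * sqrt (1 - (deriv \<phi> t)\<^sup>2) ^ (n - 3))"

definition integration_constant :: "nat \<Rightarrow> real \<Rightarrow> (real \<Rightarrow> real) \<Rightarrow> real set \<Rightarrow> real \<Rightarrow> bool" where
  "integration_constant n K \<phi> J C \<longleftrightarrow>
     (\<forall>t\<in>interior J. K * \<phi> t ^ (n - 1) = sqrt (1 - (deriv \<phi> t)\<^sup>2) ^ (n - 1) + C)"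

definition integrand :: "nat \<Rightarrow> real \<Rightarrow> real \<Rightarrow> real \<Rightarrow> real" where
  "integrand n K C x = 1 / sqrt (1 - (K * x ^ (n - 1) - C) powr (2 / (real n - 1)))"

definition lower_radius :: "nat \<Rightarrow> real \<Rightarrow> real \<Rightarrow> real" where
  "lower_radius n K C = (max 0 (C / K)) powr (1 / (real n - 1))"

definition upper_radius :: "nat \<Rightarrow> real \<Rightarrow> real \<Rightarrow> real" where
  "upper_radius n K C = ((C + 1) / K) powr (1 / (real n - 1))"

definition period_T :: "nat \<Rightarrow> real \<Rightarrow> real \<Rightarrow> real" where
  "period_T n K C = 2 * (LBINT x=lower_radius n K C..upper_radius n K C. integrand n K C x)"

text \<open>
  On \<open>A\<close> the function \<open>\<phi>\<close> is invertible, and its inverse is given by the integral formula with the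
  sign \<open>\<sigma>\<close> in the integrand.  Interval integrals are oriented, so neither \<open>t0 \<le> t\<close> nor
  \<open>\<phi> t0 \<le> y\<close> is needed; integrability is part of the claim since the integrand is singular at
  \<open>upper_radius\<close>.
\<close>

definition inverse_branch ::
    "nat \<Rightarrow> real \<Rightarrow> real \<Rightarrow> (real \<Rightarrow> real) \<Rightarrow> real set \<Rightarrow> real \<Rightarrow> bool" where
  "inverse_branch n K C \<phi> A \<sigma> \<longleftrightarrow>
     inj_on \<phi> A \<and>
     (\<forall>t0\<in>A. \<forall>y\<in>\<phi> ` A.
        interval_lebesgue_integrable lborel (\<phi> t0) y (integrand n K C) \<and>
        the_inv_into A \<phi> y - t0 = (LBINT x=\<phi> t0..y. \<sigma> * integrand n K C x))"

text \<open>
  A subdivision \<open>p 0 = t0, \<dots>, p m = t\<close> of the segment from \<open>t0\<close> to \<open>t\<close> (in either direction)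
  such that \<open>\<phi>'\<close> has the constant sign \<open>\<sigma> i\<close> inside the \<open>i\<close>-th piece.
\<close>

definition sign_subdivision ::
    "(real \<Rightarrow> real) \<Rightarrow> real \<Rightarrow> real \<Rightarrow> nat \<Rightarrow> (nat \<Rightarrow> real) \<Rightarrow> (nat \<Rightarrow> real) \<Rightarrow> bool" where
  "sign_subdivision \<phi> t0 t m p \<sigma> \<longleftrightarrow>
     p 0 = t0 \<and> p m = t \<and> (mono_on {..m} p \<or> antimono_on {..m} p) \<and>
     (\<forall>i<m. \<sigma> i \<in> {1, -1} \<and>
        (\<forall>s\<in>open_segment (p i) (p (Suc i)). sgn (deriv \<phi> s) = \<sigma> i))"

text \<open>
  The integral from \<open>\<phi> t0\<close> to \<open>\<phi> t\<close> taken piecewise along the curve, with the sign of the integrand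
  on each piece being that of \<open>\<phi>'\<close>.
\<close>

definition piecewise_integral ::
    "nat \<Rightarrow> real \<Rightarrow> real \<Rightarrow> (real \<Rightarrow> real) \<Rightarrow> nat \<Rightarrow> (nat \<Rightarrow> real) \<Rightarrow> (nat \<Rightarrow> real) \<Rightarrow> real" where
  "piecewise_integral n K C \<phi> m p \<sigma> =
     (\<Sum>i<m. LBINT x=\<phi> (p i)..\<phi> (p (Suc i)). \<sigma> i * integrand n K C x)"

end

theory Submission
  imports Defs
begin

text \<open>
  The first integral expresses both \<open>sqrt (1 - \<phi>'\<^sup>2)\<close> and \<open>\<bar>\<phi>'\<bar>\<close> as functions \<open>W \<phi>\<close> and \<open>q \<phi>\<close> of
  the radius, and the integrand is \<open>1 / q\<close>.  Its primitive \<open>arc\<close> therefore grows at unit speed along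
  every branch with \<open>\<phi>' > 0\<close> and decreases at unit speed where \<open>\<phi>' < 0\<close>, which is the integral
  formula.  A lower bound \<open>q x \<ge> c * sqrt (u - x)\<close> makes the singularity at the upper radius \<open>u\<close>
  integrable, so \<open>arc\<close> maps \<open>[l, u]\<close> homeomorphically onto \<open>[0, T / 2]\<close>.  With \<open>F\<close> the inverse of
  \<open>arc\<close>, the maximal solution centred at \<open>c\<close> is \<open>F (T / 2 - \<bar>t - c\<bar>)\<close>; its first two derivatives
  extend over \<open>t = c\<close> as limits from both sides.  Conversely the equation forces \<open>\<phi> > 0\<close>, \<open>C > -1\<close> and
  \<open>\<phi>'' < 0\<close> in the interior, so \<open>\<phi>'\<close> changes sign at most once and some \<open>c\<close> satisfies
  \<open>\<bar>t - c\<bar> = T / 2 - arc (\<phi> t)\<close> on all of \<open>J\<close>.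
\<close>

section \<open>Derivatives as limits, and roots as real powers\<close>

text \<open>L'Hospital's rule applied to the difference quotient. It yields the derivatives of the
  maximal solution at its centre, where the two branches meet.\<close>

lemma has_field_derivative_of_limit:
  fixes f f' :: "real \<Rightarrow> real"
  assumes "isCont f a"
    and "eventually (\<lambda>x. (f has_real_derivative f' x) (at x)) (at a)"
    and "(f' \<longlongrightarrow> L) (at a)"
  shows "(f has_real_derivative L) (at a)"
  unfolding has_field_derivative_iff
proof (rule lhopital[where f' = f' and g' = "\<lambda>_. 1"])
  show "((\<lambda>x. f x - f a) \<longlongrightarrow> 0) (at a)"
    using assms(1) by (simp add: isCont_def LIM_zero_iff)
  show "((\<lambda>x. x - a) \<longlongrightarrow> 0) (at a)"
    by (simp add: LIM_zero_iff)
  show "\<forall>\<^sub>F x in at a. x - a \<noteq> 0"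
    by (simp add: eventually_at_filter)
  show "\<forall>\<^sub>F x in at a. ((\<lambda>x. f x - f a) has_real_derivative f' x) (at x)"
    using assms(2) by eventually_elim (auto intro!: derivative_eq_intros)
  show "\<forall>\<^sub>F x in at a. ((\<lambda>x. x - a) has_real_derivative 1) (at x)"
    by (intro always_eventually allI) (auto intro!: derivative_eq_intros)
qed (use assms(3) in auto)

lemma root_powr_power:
  fixes y :: real
  assumes "0 \<le> y" and "n \<ge> 3"
  shows "(y powr (1 / (real n - 1))) ^ (n - 1) = y"
proof (cases "y = 0")
  case False
  then have "(y powr (1 / (real n - 1))) ^ (n - 1) = y powr (real (n - 1) * (1 / (real n - 1)))"
    by (rule powr_power)
  also have "real (n - 1) * (1 / (real n - 1)) = 1"
    using assms(2) by (simp add: of_nat_diff)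
  finally show ?thesis
    using assms(1) False by simp
qed (use assms in auto)

section \<open>The first integral as a function of the radius\<close>

locale curvature_profile =
  fixes n :: nat and K C :: real
  assumes n: "n \<ge> 3" and K: "K > 0" and C: "C > -1"
begin

declare One_nat_def [simp del]

abbreviation l where "l \<equiv> lower_radius n K C"
abbreviation u where "u \<equiv> upper_radius n K C"
abbreviation g where "g \<equiv> integrand n K C"

text \<open>By the first integral this is the value of
  \<open>sqrt (1 - \<phi>'\<^sup>2) ^ (n - 1)\<close> at radius \<open>x\<close>. Among the
  nonnegative radii, \<open>[l, u]\<close> consists of those at which it lies in
  \<open>[0, 1]\<close>.\<close>

definition U :: "real \<Rightarrow> real" where
  "U x = K * x ^ (n - 1) - C"

text \<open>\<open>W\<close> and \<open>q\<close> are \<open>sqrt (1 - \<phi>'\<^sup>2)\<close> and \<open>\<bar>\<phi>'\<bar>\<close> as functions of the radius.\<close>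

definition W :: "real \<Rightarrow> real" where
  "W x = U x powr (1 / (real n - 1))"

definition q :: "real \<Rightarrow> real" where
  "q x = sqrt (1 - (W x)\<^sup>2)"

lemma W_nonneg: "0 \<le> W x"
  by (simp add: W_def)

lemma W_power: "0 \<le> U x \<Longrightarrow> W x ^ (n - 1) = U x"
  unfolding W_def using n by (rule root_powr_power[rotated])

lemma U_powr: "U x powr (2 / (real n - 1)) = (W x)\<^sup>2"
  by (simp add: W_def power2_eq_square flip: powr_add)

lemma g_eq: "g x = 1 / q x"
  unfolding integrand_def q_def using U_powr[of x] by (simp add: U_def)

lemma lower_power: "l ^ (n - 1) = max 0 (C / K)"
  unfolding lower_radius_def using n by (intro root_powr_power) auto

lemma upper_power: "u ^ (n - 1) = (C + 1) / K"
  unfolding upper_radius_def using n K C by (intro root_powr_power) auto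

lemma lower_nonneg: "0 \<le> l" and upper_nonneg: "0 \<le> u"
  by (simp_all add: lower_radius_def upper_radius_def)

text \<open>Since \<open>l\<close> and \<open>u\<close> are known through their powers, comparing
  powers reduces every comparison with \<open>l\<close> or \<open>u\<close> to one of
  \<open>U\<close> with 0 or 1.\<close>

lemma less_iff_power: "0 \<le> x \<Longrightarrow> 0 \<le> y \<Longrightarrow> x < y \<longleftrightarrow> x ^ (n - 1) < (y::real) ^ (n - 1)"
  using n power_mono_iff[of y x "n - 1"] by (auto simp: not_le[symmetric] simp del: not_le)

text \<open>The condition \<open>0 < x\<close> is there for \<open>C < 0\<close>: then
  \<open>l = 0\<close>, while \<open>U 0 = - C\<close> is already positive.\<close>

lemma lower_less_iff: "0 \<le> x \<Longrightarrow> l < x \<longleftrightarrow> 0 < U x \<and> 0 < x"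
  using less_iff_power[of l x] less_iff_power[of 0 x] lower_nonneg K n
  by (auto simp: lower_power U_def field_simps)

lemma less_upper_iff: "0 \<le> x \<Longrightarrow> x < u \<longleftrightarrow> U x < 1"
  using less_iff_power[of x u] upper_nonneg K
  by (auto simp: upper_power U_def field_simps)

lemma lower_le_iff: "0 \<le> x \<Longrightarrow> l \<le> x \<longleftrightarrow> 0 \<le> U x"
  using less_iff_power[of x l] lower_nonneg K n
  by (auto simp: lower_power U_def field_simps not_less[symmetric] less_max_iff_disj
      simp del: not_less)

lemma le_upper_iff: "0 \<le> x \<Longrightarrow> x \<le> u \<longleftrightarrow> U x \<le> 1"
  using less_iff_power[of u x] upper_nonneg K
  by (auto simp: upper_power U_def field_simps not_less[symmetric] simp del: not_less)

lemma lower_less_upper: "l < u"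
  using less_iff_power[OF lower_nonneg upper_nonneg] K C
  by (simp add: lower_power upper_power field_simps)

lemma U_nonneg: "l \<le> x \<Longrightarrow> 0 \<le> U x"
  using lower_le_iff[of x] lower_nonneg by auto

lemma U_pos: "l < x \<Longrightarrow> 0 < U x"
  using lower_less_iff[of x] lower_nonneg by auto

lemma U_le_1: "l \<le> x \<Longrightarrow> x \<le> u \<Longrightarrow> U x \<le> 1"
  using le_upper_iff[of x] lower_nonneg by auto

lemma U_less_1: "l \<le> x \<Longrightarrow> x < u \<Longrightarrow> U x < 1"
  using less_upper_iff[of x] lower_nonneg by auto

lemma U_upper: "U u = 1"
  using K by (simp add: U_def upper_power)

lemma W_upper: "W u = 1" and q_upper: "q u = 0"
  by (simp_all add: W_def q_def U_upper)

lemma W_le_1: "l \<le> x \<Longrightarrow> x \<le> u \<Longrightarrow> W x \<le> 1"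
  using n U_nonneg[of x] U_le_1[of x] by (auto simp: W_def intro!: powr_le1)

lemma W_less_1: "l \<le> x \<Longrightarrow> x < u \<Longrightarrow> W x < 1"
  using n U_nonneg[of x] U_less_1[of x] powr_less_mono2[of "1 / (real n - 1)" "U x" 1]
  by (simp add: W_def)

lemma W_pos: "l < x \<Longrightarrow> 0 < W x"
  using U_pos[of x] by (simp add: W_def)

lemma q_nonneg: "l \<le> x \<Longrightarrow> x \<le> u \<Longrightarrow> 0 \<le> q x"
  using W_le_1[of x] W_nonneg[of x] by (simp add: q_def abs_square_le_1)

lemma q_pos: "l \<le> x \<Longrightarrow> x < u \<Longrightarrow> 0 < q x"
  using W_less_1[of x] W_nonneg[of x] by (simp add: q_def abs_square_less_1)

lemma q_squared: "l \<le> x \<Longrightarrow> x \<le> u \<Longrightarrow> (q x)\<^sup>2 = 1 - (W x)\<^sup>2"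
  using W_le_1[of x] W_nonneg[of x] by (simp add: q_def abs_square_le_1)

section \<open>Continuity and derivatives of \<open>W\<close> and \<open>q\<close>\<close>

lemma continuous_on_W: "continuous_on {l..u} W"
  unfolding W_def U_def
proof (intro continuous_on_powr' continuous_intros ballI conjI impI)
  fix x assume "x \<in> {l..u}"
  then show "0 \<le> K * x ^ (n - 1) - C"
    using U_nonneg[of x] by (simp add: U_def)
qed (use n in auto)

lemma continuous_on_q: "continuous_on {l..u} q"
  unfolding q_def by (intro continuous_intros continuous_on_W)

lemma isCont_q: "l < x \<Longrightarrow> x < u \<Longrightarrow> isCont q x"
  using continuous_on_q continuous_on_interior[of "{l..u}" q x] by auto

lemma isCont_g: "l < x \<Longrightarrow> x < u \<Longrightarrow> isCont g x"
  unfolding g_eq[abs_def] using isCont_q[of x] q_pos[of x]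
  by (intro continuous_intros) auto

lemma W_deriv:
  assumes "l < x"
  shows "(W has_real_derivative K * x ^ (n - 2) / W x ^ (n - 2)) (at x)"
proof -
  have U: "0 < U x"
    using assms by (rule U_pos)
  have "(U has_real_derivative K * (real (n - 1) * x ^ (n - 2))) (at x)"
    unfolding U_def[abs_def] by (auto intro!: derivative_eq_intros simp: numeral_2_eq_2)
  from DERIV_powr[OF this U DERIV_const[of "1 / (real n - 1)"]]
  have "(W has_real_derivative
      W x * (1 / (real n - 1) * (K * (real (n - 1) * x ^ (n - 2))) / U x)) (at x)"
    unfolding W_def[abs_def] by (simp add: mult.commute)
  moreover have "W x * (1 / (real n - 1) * (K * (real (n - 1) * x ^ (n - 2))) / U x)
      = K * x ^ (n - 2) / W x ^ (n - 2)"
  proof -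
    have n1: "n - 1 = Suc (n - 2)"
      using n by simp
    \<comment> \<open>The factor \<open>W x / U x\<close> left by the power rule becomes
      \<open>1 / W x ^ (n - 2)\<close>.\<close>
    have "U x = W x * W x ^ (n - 2)"
      using W_power[of x] U n by (simp add: n1)
    then show ?thesis
      using n W_pos[OF assms] by (simp add: of_nat_diff field_simps)
  qed
  ultimately show ?thesis by simp
qed

text \<open>Along a solution \<open>\<phi>' = \<sigma> * q \<phi>\<close> with constant sign, so
  \<open>\<phi>''\<close> is \<open>q\<close> times this derivative. The factor
  \<open>1 / q x\<close> cancels and the right-hand side of the equation solved for
  \<open>\<phi>''\<close> remains.\<close>

lemma q_deriv:
  assumes "l < x" "x < u"
  shows "(q has_real_derivative - (K * x ^ (n - 2) / W x ^ (n - 3)) / q x) (at x)"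
proof -
  have W: "0 < W x" "W x < 1"
    using assms W_pos[of x] W_less_1[of x] by auto
  then have pos: "0 < 1 - (W x)\<^sup>2"
    by (simp add: abs_square_less_1)
  have eq: "n - 2 = Suc (n - 3)" using n by simp
  have "((\<lambda>x. 1 - (W x)\<^sup>2) has_real_derivative - (2 * W x * (K * x ^ (n - 2) / W x ^ (n - 2)))) (at x)"
    by (rule derivative_eq_intros W_deriv assms refl)+ simp
  from DERIV_chain2[OF DERIV_real_sqrt[OF pos] this] show ?thesis
    unfolding q_def[abs_def] using W by (simp add: eq divide_simps mult.commute)
qed


section \<open>The arclength primitive\<close>

text \<open>Bernoulli's inequality bounds \<open>1 - W x\<close> below by
  \<open>(1 - U x) / (n - 1)\<close>, and \<open>1 - U x = K * (u ^ (n - 1) - x ^ (n - 1))\<close>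
  is at least linear in \<open>u - x\<close>. So \<open>q\<close> vanishes at \<open>u\<close> no
  faster than a square root.\<close>

lemma q_lower_bound:
  assumes "l \<le> x" "x \<le> u"
  shows "sqrt (K * u ^ (n - 2) / (real n - 1) * (u - x)) \<le> q x"
  unfolding q_def
proof (rule real_sqrt_le_mono)
  have "1 + real (n - 1) * (W x - 1) \<le> (1 + (W x - 1)) ^ (n - 1)"
    using W_nonneg[of x] by (intro Bernoulli_inequality) simp
  then have *: "1 - U x \<le> (real n - 1) * (1 - W x)"
    using n W_power[OF U_nonneg[OF assms(1)]] by (simp add: of_nat_diff algebra_simps)
  have "K * (u ^ (n - 2) * (u - x)) \<le> K * (u ^ (n - 1) - x ^ (n - 1))"
  proof (intro mult_left_mono)
    have "x * x ^ (n - 2) \<le> x * u ^ (n - 2)"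
      using assms lower_nonneg by (intro mult_left_mono power_mono) auto
    moreover have "n - 1 = Suc (n - 2)"
      using n by simp
    ultimately show "u ^ (n - 2) * (u - x) \<le> u ^ (n - 1) - x ^ (n - 1)"
      by (simp add: algebra_simps)
  qed (use K in simp)
  also have "\<dots> = 1 - U x"
    using U_upper by (simp add: U_def algebra_simps)
  also note *
  finally have "K * u ^ (n - 2) / (real n - 1) * (u - x) \<le> 1 - W x"
    using n by (simp add: field_simps)
  also have "\<dots> \<le> 1 - (W x)\<^sup>2"
    using W_nonneg[of x] W_le_1[OF assms] by (simp add: power2_eq_square mult_left_le)
  finally show "K * u ^ (n - 2) / (real n - 1) * (u - x) \<le> 1 - (W x)\<^sup>2" .
qed

lemma g_measurable: "g \<in> borel_measurable borel"
  unfolding integrand_def[abs_def] by measurable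

text \<open>Comparison with the reciprocal of the square root bounding \<open>q\<close> from
  below.\<close>

lemma g_integrable_open: "set_integrable lborel {l<..<u} g"
proof -
  define c where "c = K * u ^ (n - 2) / (real n - 1)"
  have c: "0 < c"
    using n K lower_less_upper lower_nonneg by (auto simp: c_def)
  define h where "h x = 1 / sqrt (c * (u - x))" for x
  \<comment> \<open>An explicit primitive of \<open>h\<close>, continuous up to \<open>u\<close>.
    The fundamental theorem for nonnegative integrands then gives integrability of \<open>h\<close>
    despite its singularity there.\<close>
  define H where "H x = - (2 / c) * sqrt (c * (u - x))" for x
  have contH: "isCont H x" for x
    unfolding H_def by (intro continuous_intros)
  have "set_integrable lborel (einterval (ereal l) (ereal u)) h"
  proof (rule interval_integral_FTC_nonneg(1)[where F = H and A = "H l" and B = "H u"])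
    fix x assume "ereal l < ereal x" "ereal x < ereal u"
    then have x: "0 < c * (u - x)"
      using c by simp
    have "((\<lambda>x. c * (u - x)) has_real_derivative - c) (at x)"
      by (auto intro!: derivative_eq_intros)
    from DERIV_cmult[OF DERIV_chain2[OF DERIV_real_sqrt[OF x] this], of "- (2 / c)"]
    show "(H has_real_derivative h x) (at x)"
      unfolding H_def h_def using c by (simp add: inverse_eq_divide)
    show "isCont h x"
      unfolding h_def using x by (intro continuous_intros) auto
  next
    show "AE x in lborel. ereal l < ereal x \<longrightarrow> ereal x < ereal u \<longrightarrow> 0 \<le> h x"
      using c by (auto simp: h_def)
    show "((H \<circ> real_of_ereal) \<longlongrightarrow> H l) (at_right (ereal l))"
      using contH[of l] by (auto simp: ereal_tendsto_simps isCont_def filterlim_at_split)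
    show "((H \<circ> real_of_ereal) \<longlongrightarrow> H u) (at_left (ereal u))"
      using contH[of u] by (auto simp: ereal_tendsto_simps isCont_def filterlim_at_split)
  qed (use lower_less_upper in auto)
  then have "set_integrable lborel {l<..<u} h"
    by simp
  then show ?thesis
  proof (rule set_integrable_bound)
    show "set_borel_measurable lborel {l<..<u} g"
      unfolding set_borel_measurable_def using g_measurable by measurable
    have "norm (g x) \<le> norm (h x)" if "l < x" "x < u" for x
    proof -
      have "0 < sqrt (c * (u - x))" "sqrt (c * (u - x)) \<le> q x"
        using that c q_lower_bound[of x, folded c_def] by auto
      then show ?thesis
        by (simp add: g_eq h_def frac_le)
    qed
    then show "AE x in lborel. x \<in> {l<..<u} \<longrightarrow> norm (g x) \<le> norm (h x)"
      by auto
  qed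
qed

text \<open>The two endpoints form a null set. At \<open>u\<close> the integrand has the default
  value \<open>1 / 0 = 0\<close>.\<close>

lemma g_integrable: "set_integrable lborel {l..u} g"
proof -
  have "set_integrable lborel {l..u} g \<longleftrightarrow> set_integrable lborel {l<..<u} g"
    by (rule set_integrable_discrete_difference[where X = "{l, u}"]) auto
  then show ?thesis
    using g_integrable_open by simp
qed

lemma g_integrable_on: "g integrable_on {l..u}"
  using g_integrable by (rule set_borel_integral_eq_integral)

lemma g_interval_integrable:
  assumes "l \<le> a" "a \<le> u" "l \<le> b" "b \<le> u"
  shows "interval_lebesgue_integrable lborel (ereal a) (ereal b) g"
  unfolding interval_lebesgue_integrable_def
  using assms by (auto intro!: set_integrable_subset[OF g_integrable])

text \<open>The time that a branch needs to move between the radii \<open>l\<close> and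
  \<open>x\<close>.\<close>

definition arc :: "real \<Rightarrow> real" where
  "arc x = (LBINT y=l..x. g y)"

lemma arc_diff:
  assumes "l \<le> a" "a \<le> u" "l \<le> b" "b \<le> u"
  shows "(LBINT y=a..b. g y) = arc b - arc a"
proof -
  have "(LBINT y=l..a. g y) + (LBINT y=a..b. g y) = (LBINT y=l..b. g y)"
    using assms by (intro interval_integral_sum)
      (auto simp: min_def max_def intro!: g_interval_integrable)
  then show ?thesis
    by (simp add: arc_def)
qed

lemma arc_lower: "arc l = 0" and arc_upper: "arc u = period_T n K C / 2"
  by (simp_all add: arc_def period_T_def)

lemma arc_eq_integral: "l \<le> x \<Longrightarrow> x \<le> u \<Longrightarrow> arc x = integral {l..x} g"
  unfolding arc_def
  by (intro interval_integral_eq_integral set_integrable_subset[OF g_integrable]) auto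

lemma continuous_on_arc: "continuous_on {l..u} arc"
  using indefinite_integral_continuous_1[OF g_integrable_on]
  by (rule continuous_on_eq) (auto simp: arc_eq_integral)

text \<open>Strictly between the two radii the integrand is continuous, so the fundamental theorem
  of calculus applies.\<close>

lemma arc_deriv:
  assumes "l < x" "x < u"
  shows "(arc has_real_derivative g x) (at x)"
proof -
  have "((\<lambda>y. integral {l..y} g) has_vector_derivative g x) (at x within ({l..u} - {}))"
    using assms isCont_g[of x] g_integrable_on
    by (intro integral_has_vector_derivative_continuous_at)
      (auto intro: continuous_at_imp_continuous_at_within)
  moreover have "at x within {l..u} = at x"
    using assms by (intro at_within_interior) auto
  ultimately have "((\<lambda>y. integral {l..y} g) has_real_derivative g x) (at x)"
    by (simp add: has_real_derivative_iff_has_vector_derivative)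
  then show ?thesis
    by (rule has_field_derivative_transform_within_open[where S = "{l<..<u}"])
      (use assms in \<open>auto simp: arc_eq_integral\<close>)
qed

lemma arc_strict_mono: "strict_mono_on {l..u} arc"
proof (rule strict_mono_onI)
  fix r s assume "r \<in> {l..u}" "s \<in> {l..u}" and rs: "r < s"
  show "arc r < arc s"
  proof (rule DERIV_pos_imp_increasing_open[OF rs])
    fix x assume "r < x" "x < s"
    then have "l < x" "x < u"
      using \<open>r \<in> _\<close> \<open>s \<in> _\<close> by auto
    then show "\<exists>y. (arc has_real_derivative y) (at x) \<and> y > 0"
      using arc_deriv[of x] q_pos[of x] by (auto simp: g_eq intro!: exI[of _ "1 / q x"])
  next
    show "continuous_on {r..s} arc"
      using \<open>r \<in> _\<close> \<open>s \<in> _\<close> by (auto intro: continuous_on_subset[OF continuous_on_arc])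
  qed
qed

lemma arc_inj: "inj_on arc {l..u}"
  using arc_strict_mono by (rule strict_mono_on_imp_inj_on)

lemma period_pos: "0 < period_T n K C"
  using strict_mono_onD[OF arc_strict_mono, of l u] lower_less_upper
  by (simp add: arc_lower arc_upper)

section \<open>The integral formula along a branch\<close>

text \<open>By the chain rule \<open>arc (f t)\<close> has derivative
  \<open>(1 / q) * (\<sigma> * q) = \<sigma>\<close>. Continuity carries the result to the endpoints
  of \<open>A\<close>, where \<open>f\<close> may reach \<open>l\<close> or
  \<open>u\<close>.\<close>

lemma arc_along_branch:
  assumes A: "is_interval A" and f: "continuous_on A f" "\<And>t. t \<in> A \<Longrightarrow> f t \<in> {l..u}"
    and deriv: "\<And>t. t \<in> interior A \<Longrightarrow> (f has_real_derivative \<sigma> * q (f t)) (at t)"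
    and range: "\<And>t. t \<in> interior A \<Longrightarrow> l < f t \<and> f t < u"
    and t: "s \<in> A" "t \<in> A"
  shows "arc (f t) - arc (f s) = \<sigma> * (t - s)"
proof -
  have *: "arc (f t) - arc (f s) = \<sigma> * (t - s)" if st: "s \<in> A" "t \<in> A" "s < t" for s t
  proof -
    have sub: "{s..t} \<subseteq> A"
      using mem_is_interval_1_I[OF A st(1,2)] by auto
    then have int: "{s<..<t} \<subseteq> interior A"
      by (intro interior_maximal) auto
    have "arc (f t) - \<sigma> * t = arc (f s) - \<sigma> * s"
    proof (rule DERIV_isconst_end[OF \<open>s < t\<close>, where f = "\<lambda>x. arc (f x) - \<sigma> * x"])
      show "continuous_on {s..t} (\<lambda>x. arc (f x) - \<sigma> * x)"
        using sub f(2) by (intro continuous_intros continuous_on_compose2[OF continuous_on_arc]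
            continuous_on_subset[OF f(1)]) auto
      fix x assume "s < x" "x < t"
      then have x: "x \<in> interior A"
        using int by auto
      then have "0 < q (f x)"
        using range[OF x] by (intro q_pos) auto
      then show "((\<lambda>x. arc (f x) - \<sigma> * x) has_real_derivative 0) (at x)"
        using DERIV_diff[OF DERIV_chain2[OF arc_deriv deriv[OF x]] DERIV_cmult_Id[of \<sigma>]] range[OF x]
        by (simp add: g_eq)
    qed
    then show ?thesis
      by (simp add: algebra_simps)
  qed
  show ?thesis
  proof (cases s t rule: linorder_cases)
    case less
    then show ?thesis by (rule *[OF t])
  next
    case greater
    then show ?thesis
      using *[OF t(2,1)] by (simp add: algebra_simps)
  qed simp
qed

lemma inverse_branchI:
  assumes \<sigma>: "\<sigma> \<in> {1, -1}"
    and "is_interval A" "continuous_on A f" and range: "\<And>t. t \<in> A \<Longrightarrow> f t \<in> {l..u}"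
    and "\<And>t. t \<in> interior A \<Longrightarrow> (f has_real_derivative \<sigma> * q (f t)) (at t)"
    and "\<And>t. t \<in> interior A \<Longrightarrow> l < f t \<and> f t < u"
  shows "inverse_branch n K C f A \<sigma>"
proof -
  have arc: "arc (f t) - arc (f s) = \<sigma> * (t - s)" if "s \<in> A" "t \<in> A" for s t
    using arc_along_branch[OF assms(2-6) that] by blast
  have inj: "inj_on f A"
  proof (rule inj_onI)
    fix s t assume "s \<in> A" "t \<in> A" "f s = f t"
    then show "s = t"
      using arc[of s t] \<sigma> by auto
  qed
  \<comment> \<open>Bounds of interval integrals are extended reals, so the inverse that occurs here
    is that of \<open>f\<close> followed by \<open>ereal\<close>, evaluated at
    \<open>ereal (f t)\<close>.\<close>
  moreover have "interval_lebesgue_integrable lborel (f s) (f t) g \<and>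
      the_inv_into A (\<lambda>x. ereal (f x)) (ereal (f t)) - s = (LBINT x=f s..f t. \<sigma> * g x)" if "s \<in> A" "t \<in> A" for s t
  proof -
    have "(LBINT x=f s..f t. \<sigma> * g x) = \<sigma> * (\<sigma> * (t - s))"
      using arc[OF that] range[OF that(1)] range[OF that(2)] by (simp add: arc_diff)
    also have "\<dots> = t - s"
      using \<sigma> by auto
    moreover have "the_inv_into A (\<lambda>x. ereal (f x)) (ereal (f t)) = t"
      using that inj by (intro the_inv_into_f_f) (auto simp: inj_on_def)
    ultimately show ?thesis
      using range[OF that(1)] range[OF that(2)] by (simp add: g_interval_integrable)
  qed
  ultimately show ?thesis
    by (simp add: inverse_branch_def)
qed

section \<open>The maximal solution\<close>

abbreviation h where "h \<equiv> period_T n K C / 2"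

lemma arc_image: "arc ` {l..u} = {0..h}"
proof (intro equalityI subsetI)
  fix y assume "y \<in> arc ` {l..u}"
  then obtain x where x: "x \<in> {l..u}" and y: "y = arc x"
    by blast
  then have "arc l \<le> arc x" "arc x \<le> arc u"
    using strict_mono_on_leD[OF arc_strict_mono] by auto
  then show "y \<in> {0..h}"
    unfolding y by (simp add: arc_lower arc_upper)
next
  fix y assume "y \<in> {0..h}"
  then obtain x where "l \<le> x" "x \<le> u" "arc x = y"
    using IVT'[of arc l y u] continuous_on_arc lower_less_upper
    by (auto simp: arc_lower arc_upper)
  then show "y \<in> arc ` {l..u}"
    by auto
qed

text \<open>The radius reached at time \<open>y\<close> on a rising branch that starts at
  \<open>l\<close>; meaningful only for \<open>y\<close> in \<open>[0, h]\<close>.\<close>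

definition F :: "real \<Rightarrow> real" where
  "F = the_inv_into {l..u} arc"

lemma F_arc: "l \<le> x \<Longrightarrow> x \<le> u \<Longrightarrow> F (arc x) = x"
  unfolding F_def by (intro the_inv_into_f_f arc_inj) auto

lemma arc_F: "y \<in> {0..h} \<Longrightarrow> arc (F y) = y"
  unfolding F_def using arc_image by (intro f_the_inv_into_f arc_inj) auto

lemma F_range: "y \<in> {0..h} \<Longrightarrow> F y \<in> {l..u}"
  unfolding F_def using arc_image by (intro the_inv_into_into arc_inj) auto

text \<open>A continuous injection on a compact set has a continuous inverse on its image.\<close>

lemma continuous_on_F: "continuous_on {0..h} F"
  unfolding F_def arc_image[symmetric]
  by (intro continuous_on_inv_into continuous_on_arc arc_inj) auto

lemma F_0: "F 0 = l" and F_h: "F h = u"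
  using F_arc[of l] F_arc[of u] lower_less_upper by (simp_all add: arc_lower arc_upper)

lemma lower_less_F:
  assumes "0 < y" "y \<le> h"
  shows "l < F y"
proof -
  have "F y \<noteq> l"
    using arc_F[of y] assms arc_lower by auto
  then show ?thesis
    using F_range[of y] assms by auto
qed

lemma F_less_upper:
  assumes "0 \<le> y" "y < h"
  shows "F y < u"
proof -
  have "F y \<noteq> u"
    using arc_F[of y] assms arc_upper by auto
  then show ?thesis
    using F_range[of y] assms by auto
qed

lemma F_deriv:
  assumes "0 < y" "y < h"
  shows "(F has_real_derivative q (F y)) (at y)"
proof -
  have F: "l < F y" "F y < u"
    using assms by (auto intro: lower_less_F F_less_upper)
  then have "0 < q (F y)"
    by (intro q_pos) auto
  have "(F has_real_derivative inverse (g (F y))) (at y)"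
  proof (rule DERIV_inverse_function[where f = arc and g = F, OF arc_deriv[OF F] _ assms])
    show "isCont F y"
      using continuous_on_interior[OF continuous_on_F] assms by auto
  qed (use \<open>0 < q (F y)\<close> arc_F in \<open>auto simp: g_eq\<close>)
  then show ?thesis
    by (simp add: g_eq)
qed

section \<open>Gluing a rising and a falling branch at the centre\<close>

text \<open>The rising branch ends at time \<open>c\<close> at radius \<open>u\<close>; after
  \<open>c\<close> it is run through backwards.\<close>

definition Phi :: "real \<Rightarrow> real \<Rightarrow> real" where
  "Phi c t = F (h - \<bar>t - c\<bar>)"

definition dPhi :: "real \<Rightarrow> real \<Rightarrow> real" where
  "dPhi c t = - sgn (t - c) * q (Phi c t)"

lemma Phi_center: "Phi c c = u"
  by (simp add: Phi_def F_h)

lemma Phi_ends: "Phi c (c - h) = l" "Phi c (c + h) = l"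
  using period_pos by (simp_all add: Phi_def F_0)

lemma Phi_range: "\<bar>t - c\<bar> \<le> h \<Longrightarrow> Phi c t \<in> {l..u}"
  unfolding Phi_def by (intro F_range) auto

lemma lower_less_Phi: "\<bar>t - c\<bar> < h \<Longrightarrow> l < Phi c t"
  unfolding Phi_def by (intro lower_less_F) auto

lemma Phi_less_upper: "\<bar>t - c\<bar> \<le> h \<Longrightarrow> t \<noteq> c \<Longrightarrow> Phi c t < u"
  unfolding Phi_def by (intro F_less_upper) auto

lemma mem_profile: "t \<in> {c - h..c + h} \<longleftrightarrow> \<bar>t - c\<bar> \<le> h"
  unfolding atLeastAtMost_iff abs_le_iff by linarith

lemma interior_profile: "t \<in> interior {c - h..c + h} \<longleftrightarrow> \<bar>t - c\<bar> < h"
  unfolding interior_atLeastAtMost_real greaterThanLessThan_iff abs_less_iff by linarith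

lemma continuous_on_Phi: "continuous_on {c - h..c + h} (Phi c)"
  unfolding Phi_def
  by (intro continuous_on_compose2[OF continuous_on_F] continuous_intros)
    (use mem_profile[of _ c] in auto)

lemma continuous_on_comp_Phi:
  "continuous_on {l..u} f \<Longrightarrow> continuous_on {c - h..c + h} (\<lambda>t. f (Phi c t))"
  by (rule continuous_on_compose2[OF _ continuous_on_Phi]) (assumption, rule image_subsetI, simp only: mem_profile Phi_range)

lemma isCont_comp_Phi:
  assumes "continuous_on {l..u} f" "\<bar>t - c\<bar> < h"
  shows "isCont (\<lambda>t. f (Phi c t)) t"
  by (rule continuous_on_interior[OF continuous_on_comp_Phi[OF assms(1)]])
    (use assms(2) in \<open>simp only: interior_profile\<close>)

lemma eventually_near: "\<bar>t - c\<bar> < h \<Longrightarrow> eventually (\<lambda>s. \<bar>s - c\<bar> < h) (at (t::real))"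
  using eventually_at_in_open'[of "ball c h" t] by (simp add: dist_real_def abs_minus_commute)

lemma near_center: "eventually (\<lambda>s. \<bar>s - c\<bar> < h \<and> s \<noteq> c) (at (c::real))"
  using eventually_near[of c c] eventually_neq_at_within[of c c UNIV] period_pos
  by (auto elim: eventually_elim2)

text \<open>The modulus is at most \<open>q (Phi c s)\<close>, which tends to \<open>q u = 0\<close>
  from both sides.\<close>

lemma dPhi_tendsto_center: "(dPhi c \<longlongrightarrow> 0) (at c)"
proof (rule Lim_null_comparison)
  show "((\<lambda>t. q (Phi c t)) \<longlongrightarrow> 0) (at c)"
    using isCont_comp_Phi[OF continuous_on_q, of c c] period_pos
    by (simp add: isCont_def Phi_center q_upper)
  show "\<forall>\<^sub>F s in at c. norm (dPhi c s) \<le> q (Phi c s)"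
    using near_center
  proof eventually_elim
    case (elim s)
    then have "0 \<le> q (Phi c s)"
      using Phi_range[of s c] by (intro q_nonneg) auto
    then show ?case
      by (auto simp: dPhi_def abs_mult sgn_if)
  qed
qed

text \<open>An open set around \<open>t\<close> on which the sign of \<open>s - c\<close> is fixed:
  there \<open>\<bar>s - c\<bar>\<close> is linear and \<open>dPhi\<close> has a constant sign
  factor.\<close>

lemma same_side_nhds:
  assumes "t \<noteq> (c::real)"
  shows "open {s. 0 < (t - c) * (s - c)}" "t \<in> {s. 0 < (t - c) * (s - c)}"
    and "s \<in> {s. 0 < (t - c) * (s - c)} \<Longrightarrow> sgn (s - c) = sgn (t - c)"
proof -
  show "open {s. 0 < (t - c) * (s - c)}"
    by (intro open_Collect_less continuous_intros)
qed (use assms in \<open>auto simp: zero_less_mult_iff\<close>)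

lemma Phi_deriv:
  assumes "\<bar>t - c\<bar> < h"
  shows "(Phi c has_real_derivative dPhi c t) (at t)"
proof -
  have off: "(Phi c has_real_derivative dPhi c t) (at t)" if "\<bar>t - c\<bar> < h" "t \<noteq> c" for t
  proof -
    have "((\<lambda>t. h - \<bar>t - c\<bar>) has_real_derivative - sgn (t - c)) (at t)"
    proof (rule has_field_derivative_transform_within_open)
      show "((\<lambda>s. h - sgn (t - c) * (s - c)) has_real_derivative - sgn (t - c)) (at t)"
        by (auto intro!: derivative_eq_intros)
      show "h - sgn (t - c) * (s - c) = h - \<bar>s - c\<bar>" if "s \<in> {s. 0 < (t - c) * (s - c)}" for s
        using same_side_nhds(3)[OF \<open>t \<noteq> c\<close> that] by (simp add: abs_sgn mult.commute)
    qed (use same_side_nhds[of t c] that in auto)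
    from DERIV_chain2[OF F_deriv this] that show ?thesis
      by (simp add: Phi_def[abs_def] dPhi_def mult.commute)
  qed
  show ?thesis
  proof (cases "t = c")
    case True
    \<comment> \<open>The absolute value has no derivative at \<open>c\<close>, so the chain rule is
      replaced by the limit of the derivatives nearby.\<close>
    have "(Phi c has_real_derivative 0) (at c)"
    proof (rule has_field_derivative_of_limit)
      show "isCont (Phi c) c"
        using isCont_comp_Phi[of id c c] period_pos by auto
      show "\<forall>\<^sub>F s in at c. (Phi c has_real_derivative dPhi c s) (at s)"
        using near_center by eventually_elim (simp add: off)
      show "(dPhi c \<longlongrightarrow> 0) (at c)"
        by (rule dPhi_tendsto_center)
    qed
    then show ?thesis
      by (simp add: True dPhi_def)
  qed (use off assms in auto)
qed

text \<open>The differential equation solved for \<open>\<phi>''\<close>, with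
  \<open>sqrt (1 - \<phi>'\<^sup>2)\<close> replaced by \<open>W \<phi>\<close>.\<close>

definition ddPhi :: "real \<Rightarrow> real \<Rightarrow> real" where
  "ddPhi c t = - (K * Phi c t ^ (n - 2) / W (Phi c t) ^ (n - 3))"

lemma dPhi_deriv:
  assumes "\<bar>t - c\<bar> < h"
  shows "(dPhi c has_real_derivative ddPhi c t) (at t)"
proof -
  have off: "(dPhi c has_real_derivative ddPhi c t) (at t)" if t: "\<bar>t - c\<bar> < h" "t \<noteq> c" for t
  proof -
    have P: "l < Phi c t" "Phi c t < u"
      using t by (auto intro: lower_less_Phi Phi_less_upper)
    then have "0 < q (Phi c t)"
      by (intro q_pos) auto
    \<comment> \<open>The sign occurs twice, in front of \<open>q\<close> and inside the derivative
      of \<open>Phi c\<close>, and squares to 1; hence one formula serves both sides.\<close>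
    have "((\<lambda>s. - sgn (t - c) * q (Phi c s)) has_real_derivative ddPhi c t) (at t)"
      using DERIV_cmult[OF DERIV_chain2[OF q_deriv[OF P] Phi_deriv[OF t(1)]], of "- sgn (t - c)"]
        \<open>0 < q (Phi c t)\<close> t(2) by (simp add: ddPhi_def dPhi_def sgn_if split: if_splits)
    then show ?thesis
    proof (rule has_field_derivative_transform_within_open)
      show "- sgn (t - c) * q (Phi c s) = dPhi c s" if "s \<in> {s. 0 < (t - c) * (s - c)}" for s
        using same_side_nhds(3)[OF t(2) that] by (simp add: dPhi_def)
    qed (use same_side_nhds[OF t(2)] in auto)
  qed
  show ?thesis
  proof (cases "t = c")
    case True
    have "(dPhi c has_real_derivative ddPhi c c) (at c)"
    proof (rule has_field_derivative_of_limit)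
      show "isCont (dPhi c) c"
        using dPhi_tendsto_center by (simp add: isCont_def dPhi_def)
      show "\<forall>\<^sub>F s in at c. (dPhi c has_real_derivative ddPhi c s) (at s)"
        using near_center by eventually_elim (simp add: off)
      \<comment> \<open>The quotient in \<open>ddPhi\<close> stays continuous at the centre because
        its denominator there is a power of \<open>W u = 1\<close>.\<close>
      have "isCont (\<lambda>s. W (Phi c s)) c" "isCont (\<lambda>s. Phi c s) c"
        using isCont_comp_Phi[OF continuous_on_W, of c c] isCont_comp_Phi[of id c c] period_pos by auto
      then have "isCont (ddPhi c) c"
        unfolding ddPhi_def[abs_def]
        by (intro continuous_intros) (auto simp: Phi_center W_upper)
      then show "(ddPhi c \<longlongrightarrow> ddPhi c c) (at c)"
        by (simp add: isCont_def)
    qed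
    then show ?thesis
      by (simp add: True)
  qed (use off assms in auto)
qed

lemma deriv_Phi: "\<bar>t - c\<bar> < h \<Longrightarrow> deriv (Phi c) t = dPhi c t"
  using Phi_deriv by (rule DERIV_imp_deriv)

lemma dPhi_squared: "\<bar>t - c\<bar> \<le> h \<Longrightarrow> (dPhi c t)\<^sup>2 = 1 - (W (Phi c t))\<^sup>2"
  using q_squared[of "Phi c t"] Phi_range[of t c]
  by (cases "t = c") (auto simp: dPhi_def power_mult_distrib sgn_if Phi_center W_upper)

section \<open>The glued function as a solution\<close>

lemma Phi_radius_function: "radius_function (Phi c) {c - h..c + h}"
  unfolding radius_function_def
proof (intro conjI exI ballI)
  \<comment> \<open>Unit speed and \<open>\<psi>' \<ge> 0\<close> force
    \<open>\<psi>' = sqrt (1 - \<phi>'\<^sup>2)\<close>, which is \<open>W\<close> of the radius;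
    \<open>?\<psi>\<close> integrates it.\<close>
  let ?J = "{c - h..c + h}" and ?\<psi> = "\<lambda>t. integral {c - h..t} (\<lambda>s. W (Phi c s))"
  show "continuous_on ?J (Phi c)"
    by (rule continuous_on_Phi)
  show "0 \<le> Phi c t" if "t \<in> ?J" for t
    using Phi_range[OF that[unfolded mem_profile]] lower_nonneg by auto
  show "\<exists>t\<in>?J. Phi c t \<noteq> 0"
    using lower_less_upper lower_nonneg period_pos by (intro bexI[of _ c]) (auto simp: Phi_center)
  have cont: "continuous_on ?J (\<lambda>s. W (Phi c s))"
    by (intro continuous_on_comp_Phi continuous_on_W)
  then show "continuous_on ?J ?\<psi>"
    by (intro indefinite_integral_continuous_1 integrable_continuous_real)
  fix t assume "t \<in> interior ?J"
  then have t: "\<bar>t - c\<bar> < h"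
    by (simp only: interior_profile)
  have "(?\<psi> has_real_derivative W (Phi c t)) (at t within ?J)"
    using interior_subset \<open>t \<in> interior ?J\<close>
    by (intro integral_has_real_derivative cont) blast
  then have \<psi>: "(?\<psi> has_real_derivative W (Phi c t)) (at t)"
    using at_within_interior[OF \<open>t \<in> interior ?J\<close>] by simp
  show "Phi c differentiable at t" "?\<psi> differentiable at t"
    using Phi_deriv[OF t] \<psi> real_differentiable_def by blast+
  show "(deriv (Phi c) t)\<^sup>2 + (deriv ?\<psi> t)\<^sup>2 = 1" "0 \<le> deriv ?\<psi> t"
    using t dPhi_squared[of t c] W_nonneg by (simp_all add: DERIV_imp_deriv[OF \<psi>] deriv_Phi)
qed

lemma sqrt_dPhi: "\<bar>t - c\<bar> \<le> h \<Longrightarrow> sqrt (1 - (dPhi c t)\<^sup>2) = W (Phi c t)"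
  by (simp add: dPhi_squared W_nonneg)

lemma Phi_ode_solution: "ode_solution n K (Phi c) {c - h..c + h}"
  unfolding ode_solution_def
proof (intro conjI ballI)
  show "continuous_on {c - h..c + h} (Phi c)"
    by (rule continuous_on_Phi)
  fix t assume "t \<in> interior {c - h..c + h}"
  then have t: "\<bar>t - c\<bar> < h"
    by (simp only: interior_profile)
  \<comment> \<open>\<open>deriv (Phi c)\<close> agrees with \<open>dPhi c\<close> on the open ball
    around \<open>c\<close> of radius \<open>h\<close>, so the two have the same derivative
    there.\<close>
  have dd: "(deriv (Phi c) has_real_derivative ddPhi c t) (at t)"
    using dPhi_deriv[OF t]
    by (rule has_field_derivative_transform_within_open[where S = "ball c h"])
      (use t in \<open>auto simp: dist_real_def abs_minus_commute deriv_Phi\<close>)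
  show "Phi c differentiable at t" "deriv (Phi c) differentiable at t"
    using Phi_deriv[OF t] dd real_differentiable_def by blast+
  show "K * Phi c t ^ (n - 2) =
      - deriv (deriv (Phi c)) t * sqrt (1 - (deriv (Phi c) t)\<^sup>2) ^ (n - 3)"
    using t W_pos[OF lower_less_Phi[OF t]]
    by (simp add: DERIV_imp_deriv[OF dd] deriv_Phi sqrt_dPhi ddPhi_def)
qed

lemma Phi_integration_constant: "integration_constant n K (Phi c) {c - h..c + h} C"
  unfolding integration_constant_def
proof
  fix t assume "t \<in> interior {c - h..c + h}"
  then have t: "\<bar>t - c\<bar> < h"
    by (simp only: interior_profile)
  then have "W (Phi c t) ^ (n - 1) = U (Phi c t)"
    using lower_less_Phi[OF t] by (intro W_power U_nonneg) auto
  then show "K * Phi c t ^ (n - 1) = sqrt (1 - (deriv (Phi c) t)\<^sup>2) ^ (n - 1) + C"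
    using t by (simp add: deriv_Phi sqrt_dPhi U_def)
qed

text \<open>The last four facts concern the reversed orientation
  \<open>s \<mapsto> Phi c (- s)\<close>, which reflects the time intervals and flips every
  sign.\<close>

lemma Phi_branches:
  fixes c :: real
  defines "L \<equiv> {c - h..c}" and "R \<equiv> {c..c + h}"
  shows "\<forall>t\<in>interior L. sgn (deriv (Phi c) t) = 1" "inverse_branch n K C (Phi c) L 1"
    and "\<forall>t\<in>interior R. sgn (deriv (Phi c) t) = -1" "inverse_branch n K C (Phi c) R (-1)"
    and "\<forall>s\<in>interior (uminus ` L). sgn (deriv (\<lambda>s. Phi c (- s)) s) = -1"
      "inverse_branch n K C (\<lambda>s. Phi c (- s)) (uminus ` L) (-1)"
    and "\<forall>s\<in>interior (uminus ` R). sgn (deriv (\<lambda>s. Phi c (- s)) s) = 1"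
      "inverse_branch n K C (\<lambda>s. Phi c (- s)) (uminus ` R) 1"
proof -
  have q: "0 < q (Phi c t)" "l < Phi c t" "Phi c t < u" if "\<bar>t - c\<bar> < h" "t \<noteq> c" for t
    using that lower_less_Phi[of t c] Phi_less_upper[of t c] by (auto intro!: q_pos)
  have PL: "(Phi c has_real_derivative 1 * q (Phi c t)) (at t)" "\<bar>t - c\<bar> < h" "t \<noteq> c"
    if "t \<in> interior L" for t
    using that Phi_deriv[of t c] by (auto simp: L_def dPhi_def sgn_if)
  have PR: "(Phi c has_real_derivative -1 * q (Phi c t)) (at t)" "\<bar>t - c\<bar> < h" "t \<noteq> c"
    if "t \<in> interior R" for t
    using that Phi_deriv[of t c] by (auto simp: R_def dPhi_def sgn_if)
  have rev: "((\<lambda>s. Phi c (- s)) has_real_derivative - (\<sigma> * q (Phi c (- s)))) (at s)"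
    if "(Phi c has_real_derivative \<sigma> * q (Phi c (- s))) (at (- s))" for s \<sigma>
    using DERIV_chain2[OF that DERIV_minus[OF DERIV_ident]] by simp
  have cont: "continuous_on L (Phi c)" "continuous_on R (Phi c)"
    using period_pos by (auto simp: L_def R_def intro: continuous_on_subset[OF continuous_on_Phi])
  have contr: "continuous_on (uminus ` L) (\<lambda>s. Phi c (- s))"
    "continuous_on (uminus ` R) (\<lambda>s. Phi c (- s))"
    by (rule continuous_on_compose2[OF cont(1)] continuous_on_compose2[OF cont(2)],
        intro continuous_intros, auto)+
  have range: "Phi c t \<in> {l..u}" if "t \<in> L \<union> R" for t
    using that by (intro Phi_range) (auto simp: L_def R_def)
  have int: "is_interval L" "is_interval R" "is_interval (uminus ` L)" "is_interval (uminus ` R)"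
    by (simp_all add: L_def R_def is_interval_cc)
  have intr: "s \<in> interior (uminus ` S) \<longleftrightarrow> - s \<in> interior S" for s :: real and S
    by (auto simp: interior_negations image_iff) (metis minus_minus)
  note branch = inverse_branchI[of "1::real"] inverse_branchI[of "-1::real"]
  show "\<forall>t\<in>interior L. sgn (deriv (Phi c) t) = 1" "\<forall>t\<in>interior R. sgn (deriv (Phi c) t) = -1"
    using q PL PR by (auto simp: DERIV_imp_deriv[OF PL(1)] DERIV_imp_deriv[OF PR(1)])
  show "inverse_branch n K C (Phi c) L 1"
    using q PL range by (intro branch int cont) auto
  show "inverse_branch n K C (Phi c) R (-1)"
    using q PR range by (intro branch int cont) auto
  have rL: "((\<lambda>s. Phi c (- s)) has_real_derivative -1 * q (Phi c (- s))) (at s)"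
    if "- s \<in> interior L" for s
    using rev[OF PL(1)[OF that]] by simp
  have rR: "((\<lambda>s. Phi c (- s)) has_real_derivative 1 * q (Phi c (- s))) (at s)"
    if "- s \<in> interior R" for s
    using rev[OF PR(1)[OF that]] by simp
  show "\<forall>s\<in>interior (uminus ` L). sgn (deriv (\<lambda>s. Phi c (- s)) s) = -1"
    "\<forall>s\<in>interior (uminus ` R). sgn (deriv (\<lambda>s. Phi c (- s)) s) = 1"
    using q PL(2,3) PR(2,3)
    by (auto simp: intr DERIV_imp_deriv[OF rL] DERIV_imp_deriv[OF rR])
  show "inverse_branch n K C (\<lambda>s. Phi c (- s)) (uminus ` L) (-1)"
    using q PL(2,3) rL range by (intro branch int contr) (auto simp: intr)
  show "inverse_branch n K C (\<lambda>s. Phi c (- s)) (uminus ` R) 1"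
    using q PR(2,3) rR range by (intro branch int contr) (auto simp: intr)
qed

end

section \<open>Arbitrary solutions\<close>

text \<open>A nondegenerate interval lies in the closure of its interior, and the preimage of
  \<open>S\<close> is relatively closed in \<open>J\<close>. This transfers facts obtained from the
  equation to the endpoints of \<open>J\<close>.\<close>

lemma continuous_mem_closed_of_interior:
  fixes f :: "real \<Rightarrow> real"
  assumes "is_interval J" "interior J \<noteq> {}" "continuous_on J f" "closed S"
    and "\<And>t. t \<in> interior J \<Longrightarrow> f t \<in> S" and "t \<in> J"
  shows "f t \<in> S"
proof -
  obtain T where T: "closed T" "J \<inter> f -` S = J \<inter> T"
    using continuous_closedin_preimage[OF assms(3,4)] unfolding closedin_closed by blast
  have "interior J \<subseteq> T"
    using T(2) assms(5) interior_subset by blast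
  then have "closure (interior J) \<subseteq> T"
    using T(1) by (rule closure_minimal)
  moreover have "closure (interior J) = closure J"
    using assms(1,2) by (intro convex_closure_interior is_interval_convex)
  ultimately have "t \<in> J \<inter> T"
    using \<open>t \<in> J\<close> closure_subset by blast
  then show ?thesis
    using T(2) by blast
qed

lemma inverse_branchD:
  assumes "inverse_branch n K C f A \<sigma>" "s \<in> A" "t \<in> A"
  shows "t - s = (LBINT x=f s..f t. \<sigma> * integrand n K C x)"
proof -
  have "inj_on (\<lambda>x. ereal (f x)) A"
    using assms(1) by (auto simp: inverse_branch_def inj_on_def)
  then have "the_inv_into A (\<lambda>x. ereal (f x)) (ereal (f t)) = t"
    using \<open>t \<in> A\<close> by (rule the_inv_into_f_f)
  moreover have "the_inv_into A (\<lambda>x. ereal (f x)) (ereal (f t)) - s =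
      (LBINT x=f s..f t. \<sigma> * integrand n K C x)"
    using assms unfolding inverse_branch_def by blast
  ultimately show ?thesis
    by simp
qed

lemma interior_closed_segment_real: "interior (closed_segment a b) = open_segment a (b::real)"
  by (simp add: closed_segment_eq_real_ivl open_segment_eq_real_ivl)

locale rotation_curve =
  fixes n :: nat and K C :: real and \<phi> :: "real \<Rightarrow> real" and J :: "real set"
  assumes n_ge_3: "n \<ge> 3" and K_pos: "K > 0"
    and interval: "is_interval J" and interior_nonempty: "interior J \<noteq> {}"
    and radius: "radius_function \<phi> J"
    and ode: "ode_solution n K \<phi> J"
    and first_integral: "integration_constant n K \<phi> J C"
begin

declare One_nat_def [simp del]

section \<open>Bounds forced by the equation and the first integral\<close>

lemma cont: "continuous_on J \<phi>"
  using radius by (simp add: radius_function_def)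

lemma nonneg: "t \<in> J \<Longrightarrow> 0 \<le> \<phi> t"
  using radius by (simp add: radius_function_def)

lemma deriv1: "t \<in> interior J \<Longrightarrow> (\<phi> has_real_derivative deriv \<phi> t) (at t)"
  using ode by (simp add: ode_solution_def DERIV_deriv_iff_real_differentiable)

lemma deriv2: "t \<in> interior J \<Longrightarrow> (deriv \<phi> has_real_derivative deriv (deriv \<phi>) t) (at t)"
  using ode by (simp add: ode_solution_def DERIV_deriv_iff_real_differentiable)

lemma deriv_squared_le_1: "t \<in> interior J \<Longrightarrow> (deriv \<phi> t)\<^sup>2 \<le> 1"
proof -
  assume "t \<in> interior J"
  then obtain \<psi> where "(deriv \<phi> t)\<^sup>2 + (deriv \<psi> t)\<^sup>2 = 1"
    using radius unfolding radius_function_def by blast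
  then show ?thesis
    using zero_le_power2[of "deriv \<psi> t"] by linarith
qed

lemma first_integral_eq:
  "t \<in> interior J \<Longrightarrow> K * \<phi> t ^ (n - 1) = sqrt (1 - (deriv \<phi> t)\<^sup>2) ^ (n - 1) + C"
  using first_integral by (simp add: integration_constant_def)

lemma velocity_range:
  "t \<in> interior J \<Longrightarrow> 0 \<le> sqrt (1 - (deriv \<phi> t)\<^sup>2)"
  "t \<in> interior J \<Longrightarrow> sqrt (1 - (deriv \<phi> t)\<^sup>2) \<le> 1"
  using deriv_squared_le_1[of t] by auto

text \<open>An interior zero would be a minimum, hence a critical point, and the first integral
  would give \<open>C = -1\<close>. Then \<open>K * \<phi> ^ (n - 1) \<le> 0\<close> throughout, so
  \<open>\<phi>\<close> would vanish identically.\<close>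

lemma pos: "0 < \<phi> t" if t: "t \<in> interior J"
proof (rule ccontr)
  assume "\<not> 0 < \<phi> t"
  moreover have "0 \<le> \<phi> t"
    using t interior_subset nonneg by blast
  ultimately have zero: "\<phi> t = 0"
    by simp
  obtain d where d: "0 < d" "ball t d \<subseteq> interior J"
    using t open_interior open_contains_ball by metis
  have crit: "deriv \<phi> t = 0"
  proof (rule DERIV_local_min[OF deriv1[OF t] d(1)], intro allI impI)
    fix y assume "\<bar>t - y\<bar> < d"
    then have "y \<in> J"
      using d(2) interior_subset by (auto simp: subset_iff dist_real_def)
    then show "\<phi> t \<le> \<phi> y"
      using nonneg zero by simp
  qed
  have zero_power: "\<phi> t ^ (n - 1) = 0"
    unfolding zero using n_ge_3 by (intro power_0_left[THEN trans]) simp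
  then have C: "C = -1"
    using first_integral_eq[OF t] unfolding zero_power crit by simp
  have "\<phi> s = 0" if s: "s \<in> interior J" for s
  proof -
    have "sqrt (1 - (deriv \<phi> s)\<^sup>2) ^ (n - 1) \<le> 1"
      using velocity_range[OF s] by (intro power_le_one)
    then have "K * \<phi> s ^ (n - 1) \<le> 0"
      using first_integral_eq[OF s] C by simp
    then have "\<phi> s ^ (n - 1) \<le> 0"
      using K_pos by (simp add: mult_le_0_iff)
    moreover have "0 \<le> \<phi> s"
      using s interior_subset nonneg by blast
    ultimately show ?thesis
      using zero_less_power[of "\<phi> s" "n - 1"] by (meson antisym not_le)
  qed
  \<comment> \<open>Nontriviality is assumed on \<open>J\<close>, so the zero set must be extended
    to the endpoints.\<close>
  then have "\<phi> s = 0" if "s \<in> J" for s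
    using continuous_mem_closed_of_interior[OF interval interior_nonempty cont closed_singleton[of 0]]
      that by simp
  then show False
    using radius by (auto simp: radius_function_def)
qed

lemma C_gt: "C > -1"
proof -
  obtain t where t: "t \<in> interior J"
    using interior_nonempty by blast
  have "sqrt (1 - (deriv \<phi> t)\<^sup>2) ^ (n - 1) \<le> 1"
    using velocity_range[OF t] by (intro power_le_one)
  moreover have "0 < K * \<phi> t ^ (n - 1)"
    using K_pos pos[OF t] by simp
  ultimately show ?thesis
    using first_integral_eq[OF t] by linarith
qed

sublocale curvature_profile n K C
  using n_ge_3 K_pos C_gt by unfold_locales

text \<open>The left side of the equation is positive and the square root factor is
  nonnegative.\<close>

lemma deriv2_neg:
  assumes "t \<in> interior J"
  shows "deriv (deriv \<phi>) t < 0"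
proof (rule ccontr)
  assume "\<not> deriv (deriv \<phi>) t < 0"
  then have "0 \<le> deriv (deriv \<phi>) t * sqrt (1 - (deriv \<phi> t)\<^sup>2) ^ (n - 3)"
    using velocity_range(1)[OF assms] by simp
  moreover have "K * \<phi> t ^ (n - 2) = - deriv (deriv \<phi>) t * sqrt (1 - (deriv \<phi> t)\<^sup>2) ^ (n - 3)"
    using ode assms by (simp add: ode_solution_def)
  moreover have "0 < K * \<phi> t ^ (n - 2)"
    using K_pos pos[OF assms] by simp
  ultimately show False
    by simp
qed

text \<open>Where \<open>(deriv \<phi> t)\<^sup>2 = 1\<close> this square has a local maximum, so
  \<open>2 * \<phi>' * \<phi>'' = 0\<close>, against \<open>\<phi>'' < 0\<close>. The argument
  covers \<open>n = 3\<close>, where the square root factor of the equation has exponent 0 and does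
  not vanish.\<close>

lemma deriv_squared_less_1:
  assumes t: "t \<in> interior J"
  shows "(deriv \<phi> t)\<^sup>2 < 1"
proof (rule ccontr)
  assume "\<not> (deriv \<phi> t)\<^sup>2 < 1"
  then have 1: "(deriv \<phi> t)\<^sup>2 = 1"
    using deriv_squared_le_1[OF t] by simp
  obtain d where d: "0 < d" "ball t d \<subseteq> interior J"
    using t open_interior open_contains_ball by metis
  have "2 * deriv \<phi> t * deriv (deriv \<phi>) t = 0"
  proof (rule DERIV_local_max[OF _ d(1)])
    show "((\<lambda>s. (deriv \<phi> s)\<^sup>2) has_real_derivative 2 * deriv \<phi> t * deriv (deriv \<phi>) t) (at t)"
      by (rule derivative_eq_intros deriv2[OF t])+ simp
    show "\<forall>y. \<bar>t - y\<bar> < d \<longrightarrow> (deriv \<phi> y)\<^sup>2 \<le> (deriv \<phi> t)\<^sup>2"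
      using d(2) deriv_squared_le_1 1 by (auto simp: subset_iff dist_real_def)
  qed
  then show False
    using deriv2_neg[OF t] 1 by auto
qed

lemma W_eq:
  assumes t: "t \<in> interior J"
  shows "W (\<phi> t) = sqrt (1 - (deriv \<phi> t)\<^sup>2)"
proof (rule power_eq_imp_eq_base)
  have "U (\<phi> t) = sqrt (1 - (deriv \<phi> t)\<^sup>2) ^ (n - 1)"
    using first_integral_eq[OF t] by (simp add: U_def)
  then show "W (\<phi> t) ^ (n - 1) = sqrt (1 - (deriv \<phi> t)\<^sup>2) ^ (n - 1)"
    using W_power[of "\<phi> t"] velocity_range(1)[OF t] by simp
qed (use n_ge_3 W_nonneg velocity_range(1)[OF t] in auto)

lemma q_eq: "t \<in> interior J \<Longrightarrow> q (\<phi> t) = \<bar>deriv \<phi> t\<bar>"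
  using deriv_squared_le_1[of t] by (simp add: q_def W_eq)

lemma U_eq: "t \<in> interior J \<Longrightarrow> U (\<phi> t) = sqrt (1 - (deriv \<phi> t)\<^sup>2) ^ (n - 1)"
  using first_integral_eq[of t] by (simp add: U_def)

lemma lower_less:
  assumes t: "t \<in> interior J"
  shows "l < \<phi> t"
  using lower_less_iff[of "\<phi> t"] pos[OF t] U_eq[OF t] deriv_squared_less_1[OF t] by simp

lemma le_upper:
  assumes t: "t \<in> interior J"
  shows "\<phi> t \<le> u"
  using le_upper_iff[of "\<phi> t"] pos[OF t] U_eq[OF t] power_le_one[OF velocity_range[OF t]] by simp

text \<open>By \<open>\<bar>\<phi>'\<bar> = q \<phi>\<close> critical points correspond to zeros of
  \<open>q\<close>, and on \<open>[l, u]\<close> its only zero is \<open>u\<close>.\<close>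

lemma upper_iff_critical:
  assumes t: "t \<in> interior J"
  shows "\<phi> t = u \<longleftrightarrow> deriv \<phi> t = 0"
proof
  assume "\<phi> t = u"
  then show "deriv \<phi> t = 0"
    using q_eq[OF t] q_upper by simp
next
  assume "deriv \<phi> t = 0"
  then show "\<phi> t = u"
    using q_eq[OF t] q_pos[of "\<phi> t"] lower_less[OF t] le_upper[OF t]
    by (cases "\<phi> t < u") auto
qed

lemma range: "t \<in> J \<Longrightarrow> \<phi> t \<in> {l..u}"
  by (rule continuous_mem_closed_of_interior[OF interval interior_nonempty cont])
    (use lower_less le_upper in \<open>auto intro: less_imp_le\<close>)

text \<open>The modulus of \<open>\<phi>'\<close> is \<open>q \<phi>\<close> and its sign is
  \<open>\<sigma>\<close>. A nonzero sign also keeps the radius away from \<open>u\<close>.\<close>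

lemma branch_deriv:
  assumes A: "A \<subseteq> J" and sgn: "\<And>s. s \<in> interior A \<Longrightarrow> sgn (deriv \<phi> s) = \<sigma>"
    and \<sigma>: "\<sigma> \<in> {1, -1}" and t: "t \<in> interior A"
  shows "(\<phi> has_real_derivative \<sigma> * q (\<phi> t)) (at t)" "l < \<phi> t \<and> \<phi> t < u"
proof -
  have tJ: "t \<in> interior J"
    using t interior_mono[OF A] by blast
  have "deriv \<phi> t = sgn (deriv \<phi> t) * \<bar>deriv \<phi> t\<bar>"
    by (simp add: sgn_mult_abs)
  then show "(\<phi> has_real_derivative \<sigma> * q (\<phi> t)) (at t)"
    using deriv1[OF tJ] sgn[OF t] q_eq[OF tJ] by simp
  have "deriv \<phi> t \<noteq> 0"
    using sgn[OF t] \<sigma> by auto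
  then show "l < \<phi> t \<and> \<phi> t < u"
    using lower_less[OF tJ] le_upper[OF tJ] upper_iff_critical[OF tJ] by auto
qed

lemma branch:
  assumes "A \<subseteq> J" "is_interval A" "\<sigma> \<in> {1, -1}"
    and "\<And>s. s \<in> interior A \<Longrightarrow> sgn (deriv \<phi> s) = \<sigma>"
  shows "inverse_branch n K C \<phi> A \<sigma>"
proof (rule inverse_branchI[OF assms(3,2) continuous_on_subset[OF cont assms(1)]])
  show "\<phi> t \<in> {l..u}" if "t \<in> A" for t
    using range that assms(1) by blast
qed (rule branch_deriv[OF assms(1,4,3)]; assumption)+

lemma arc_branch:
  assumes "A \<subseteq> J" "is_interval A" "\<sigma> \<in> {1, -1}"
    and "\<And>s. s \<in> interior A \<Longrightarrow> sgn (deriv \<phi> s) = \<sigma>" and "s \<in> A" "t \<in> A"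
  shows "arc (\<phi> t) - arc (\<phi> s) = \<sigma> * (t - s)"
proof (rule arc_along_branch[OF assms(2) continuous_on_subset[OF cont assms(1)] _ _ _ assms(5,6)])
  show "\<phi> t \<in> {l..u}" if "t \<in> A" for t
    using range that assms(1) by blast
qed (rule branch_deriv[OF assms(1,4,3)]; assumption)+

section \<open>Sign changes of the derivative and piecewise integrals\<close>

lemma segment_in_curve: "s \<in> J \<Longrightarrow> t \<in> J \<Longrightarrow> closed_segment s t \<subseteq> J"
  using interval by (intro Line_Segment.closed_segment_subset is_interval_convex)

lemma open_segment_in_interior: "s \<in> J \<Longrightarrow> t \<in> J \<Longrightarrow> open_segment s t \<subseteq> interior J"
  using interior_mono[OF segment_in_curve] by (simp add: interior_closed_segment_real)

lemma interval_interior: "is_interval (interior J)"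
  using interval by (simp add: is_interval_convex_1 convex_interior)

lemma deriv_strict_decreasing:
  assumes "s \<in> interior J" "t \<in> interior J" "s < t"
  shows "deriv \<phi> t < deriv \<phi> s"
proof (rule DERIV_neg_imp_decreasing[OF \<open>s < t\<close>])
  fix x assume "s \<le> x" "x \<le> t"
  then have "x \<in> interior J"
    using mem_is_interval_1_I[OF interval_interior assms(1,2)] by simp
  then show "\<exists>y. (deriv \<phi> has_real_derivative y) (at x) \<and> y < 0"
    using deriv2 deriv2_neg by blast
qed

text \<open>Intermediate value theorem for the continuous function \<open>\<phi>'\<close> on a
  connected set.\<close>

lemma constant_sign:
  assumes "convex S" "S \<subseteq> interior J" "\<And>s. s \<in> S \<Longrightarrow> deriv \<phi> s \<noteq> 0"
  shows "\<exists>\<sigma>\<in>{1, -1}. \<forall>s\<in>S. sgn (deriv \<phi> s) = \<sigma>"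
proof -
  have "continuous_on S (deriv \<phi>)"
    using assms(2) deriv2 by (meson DERIV_isCont continuous_at_imp_continuous_on subsetD)
  then have conn: "connected (deriv \<phi> ` S)"
    using assms(1) by (intro connected_continuous_image convex_connected)
  have "\<not> (deriv \<phi> s < 0 \<and> 0 < deriv \<phi> t)" if "s \<in> S" "t \<in> S" for s t
  proof
    assume "deriv \<phi> s < 0 \<and> 0 < deriv \<phi> t"
    then have "0 \<in> deriv \<phi> ` S"
      using connectedD_interval[OF conn, of "deriv \<phi> s" "deriv \<phi> t" 0] that by auto
    then show False
      using assms(3) by auto
  qed
  then have "\<not> (\<exists>s\<in>S. deriv \<phi> s < 0) \<or> \<not> (\<exists>t\<in>S. 0 < deriv \<phi> t)"
    by blast
  then show ?thesis
  proof
    assume "\<not> (\<exists>s\<in>S. deriv \<phi> s < 0)"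
    then have "\<forall>s\<in>S. sgn (deriv \<phi> s) = 1"
      using assms(3) by (force simp: sgn_if)
    then show ?thesis
      by simp
  next
    assume "\<not> (\<exists>s\<in>S. 0 < deriv \<phi> s)"
    then have "\<forall>s\<in>S. sgn (deriv \<phi> s) = -1"
      using assms(3) by (force simp: sgn_if)
    then show ?thesis
      by simp
  qed
qed

text \<open>As \<open>\<phi>'\<close> is strictly decreasing it has at most one zero, so one piece
  suffices, or two that meet at the zero.\<close>

lemma subdivision_exists:
  assumes J: "t0 \<in> J" "t \<in> J"
  shows "\<exists>m p \<sigma>. sign_subdivision \<phi> t0 t m p \<sigma>"
proof (cases "\<exists>s\<in>open_segment t0 t. deriv \<phi> s = 0")
  case False
  then obtain \<sigma> where \<sigma>: "\<sigma> \<in> {1, -1}" "\<forall>s\<in>open_segment t0 t. sgn (deriv \<phi> s) = \<sigma>"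
    using constant_sign[OF convex_open_segment open_segment_in_interior[OF J]] by blast
  have "mono_on {..1::nat} (\<lambda>i. if i = 0 then t0 else t) \<or>
      antimono_on {..1::nat} (\<lambda>i. if i = 0 then t0 else t)"
  proof (cases "t0 \<le> t")
    case True
    then have "mono_on {..1::nat} (\<lambda>i. if i = 0 then t0 else t)"
      by (intro monotone_onI) auto
    then show ?thesis ..
  next
    case False
    then have "antimono_on {..1::nat} (\<lambda>i. if i = 0 then t0 else t)"
      by (intro monotone_onI) auto
    then show ?thesis ..
  qed
  then have "sign_subdivision \<phi> t0 t 1 (\<lambda>i. if i = 0 then t0 else t) (\<lambda>_. \<sigma>)"
    using \<sigma> by (simp add: sign_subdivision_def)
  then show ?thesis
    by blast
next
  case True
  then obtain s where s: "s \<in> open_segment t0 t" "deriv \<phi> s = 0"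
    by blast
  then have sJ: "s \<in> interior J"
    using open_segment_in_interior[OF J] by blast
  then have sJ': "s \<in> J"
    using interior_subset by blast
  have unique: "deriv \<phi> r \<noteq> 0" if "r \<in> interior J" "r \<noteq> s" for r
    using deriv_strict_decreasing[of r s] deriv_strict_decreasing[of s r] that sJ s(2)
    by (cases r s rule: linorder_cases) auto
  have "\<exists>\<sigma>\<in>{1, -1}. \<forall>r\<in>open_segment a s. sgn (deriv \<phi> r) = \<sigma>" if "a \<in> J" for a
  proof (rule constant_sign[OF convex_open_segment open_segment_in_interior[OF that sJ']])
    fix r assume r: "r \<in> open_segment a s"
    then have "r \<noteq> s"
      by (auto simp: open_segment_def)
    then show "deriv \<phi> r \<noteq> 0"
      using r open_segment_in_interior[OF that sJ'] unique by blast
  qed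
  then obtain \<sigma>0 \<sigma>1 where \<sigma>: "\<sigma>0 \<in> {1, -1}" "\<forall>r\<in>open_segment t0 s. sgn (deriv \<phi> r) = \<sigma>0"
      "\<sigma>1 \<in> {1, -1}" "\<forall>r\<in>open_segment t s. sgn (deriv \<phi> r) = \<sigma>1"
    using J by metis
  define p where "p i = (if i = 0 then t0 else if i = 1 then s else t)" for i :: nat
  define \<tau> where "\<tau> i = (if i = 0 then \<sigma>0 else \<sigma>1)" for i :: nat
  have "t0 < s \<and> s < t \<or> t < s \<and> s < t0"
    using s(1) by (auto simp: open_segment_eq_real_ivl split: if_splits)
  then have mono: "mono_on {..2} p \<or> antimono_on {..2} p"
  proof
    assume "t0 < s \<and> s < t"
    then have "mono_on {..2} p"
      by (intro monotone_onI) (auto simp: p_def)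
    then show ?thesis ..
  next
    assume "t < s \<and> s < t0"
    then have "antimono_on {..2} p"
      by (intro monotone_onI) (auto simp: p_def)
    then show ?thesis ..
  qed
  have "\<tau> i \<in> {1, -1} \<and> (\<forall>r\<in>open_segment (p i) (p (Suc i)). sgn (deriv \<phi> r) = \<tau> i)"
    if "i < 2" for i
  proof -
    consider "i = 0" | "i = 1"
      using \<open>i < 2\<close> by linarith
    then show ?thesis
      by cases (use \<sigma> in \<open>simp_all add: p_def \<tau>_def open_segment_commute\<close>)
  qed
  then have "sign_subdivision \<phi> t0 t 2 p \<tau>"
    unfolding sign_subdivision_def using mono by (simp add: p_def)
  then show ?thesis
    by blast
qed

text \<open>On each piece the branch formula turns the integral into \<open>p (Suc i) - p i\<close>,
  and the sum telescopes.\<close>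

lemma piecewise_time:
  assumes J: "t0 \<in> J" "t \<in> J" and sub: "sign_subdivision \<phi> t0 t m p \<sigma>"
  shows "t - t0 = piecewise_integral n K C \<phi> m p \<sigma>"
proof -
  have ends: "p 0 = t0" "p m = t" and mono: "mono_on {..m} p \<or> antimono_on {..m} p"
    and sgn: "\<And>i. i < m \<Longrightarrow> \<sigma> i \<in> {1, -1}"
      "\<And>i s. i < m \<Longrightarrow> s \<in> open_segment (p i) (p (Suc i)) \<Longrightarrow> sgn (deriv \<phi> s) = \<sigma> i"
    using sub by (auto simp: sign_subdivision_def)
  \<comment> \<open>Monotonicity of the subdivision places every point between \<open>t0\<close> and
    \<open>t\<close>.\<close>
  have pJ: "p i \<in> J" if "i \<le> m" for i
  proof -
    have "t0 \<le> p i \<and> p i \<le> t \<or> t \<le> p i \<and> p i \<le> t0"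
      using mono that unfolding monotone_on_def ends[symmetric] by auto
    then show ?thesis
      using mem_is_interval_1_I[OF interval] J by blast
  qed
  have "p (Suc i) - p i = (LBINT x=\<phi> (p i)..\<phi> (p (Suc i)). \<sigma> i * g x)" if "i < m" for i
  proof (rule inverse_branchD)
    show "inverse_branch n K C \<phi> (closed_segment (p i) (p (Suc i))) (\<sigma> i)"
      using that sgn pJ segment_in_curve
      by (intro branch) (auto simp: interior_closed_segment_real is_interval_convex_1)
  qed auto
  then have "piecewise_integral n K C \<phi> m p \<sigma> = (\<Sum>i<m. p (Suc i) - p i)"
    by (simp add: piecewise_integral_def)
  then show ?thesis
    by (simp add: sum_lessThan_telescope ends)
qed

section \<open>Embedding a solution into the maximal one\<close>

lemma arc_le_h: "t \<in> J \<Longrightarrow> arc (\<phi> t) \<in> {0..h}"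
  using range[of t] arc_image by blast

text \<open>The centre is the time at which the curve reaches the radius \<open>u\<close>, where
  \<open>arc\<close> equals \<open>h\<close>; away from it \<open>arc \<phi>\<close> drops at unit
  speed on both sides. If \<open>\<phi>'\<close> has no zero in the interior, that time is
  extrapolated.\<close>

lemma center_exists: "\<exists>c. \<forall>t\<in>J. \<bar>t - c\<bar> = h - arc (\<phi> t)"
proof (cases "\<exists>s\<in>interior J. deriv \<phi> s = 0")
  case True
  then obtain s where s: "s \<in> interior J" "deriv \<phi> s = 0"
    by blast
  then have sJ: "s \<in> J" and top: "arc (\<phi> s) = h"
    using interior_subset upper_iff_critical[of s] arc_upper by auto
  have "\<bar>t - s\<bar> = h - arc (\<phi> t)" if t: "t \<in> J" for t
  proof -
    have seg: "arc (\<phi> t) - arc (\<phi> s) = \<sigma> * (t - s)"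
      if "\<sigma> \<in> {1, -1}" "\<And>r. r \<in> open_segment s t \<Longrightarrow> sgn (deriv \<phi> r) = \<sigma>" for \<sigma>
      using that segment_in_curve[OF sJ t]
      by (intro arc_branch[where A = "closed_segment s t"])
        (auto simp: interior_closed_segment_real is_interval_convex_1)
    have mem: "r \<in> interior J" if "r \<in> open_segment s t" for r
      using open_segment_in_interior[OF sJ t] that by blast
    show ?thesis
    proof (cases s t rule: linorder_cases)
      case less
      have "arc (\<phi> t) - arc (\<phi> s) = -1 * (t - s)"
        using deriv_strict_decreasing[OF s(1) mem] s(2) less
        by (intro seg) (auto simp: open_segment_eq_real_ivl)
      then show ?thesis
        using less top by simp
    next
      case greater
      have "arc (\<phi> t) - arc (\<phi> s) = 1 * (t - s)"
        using deriv_strict_decreasing[OF mem s(1)] s(2) greater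
        by (intro seg) (auto simp: open_segment_eq_real_ivl)
      then show ?thesis
        using greater top by simp
    qed (use top in simp)
  qed
  then show ?thesis
    by blast
next
  case False
  then obtain \<sigma> where \<sigma>: "\<sigma> \<in> {1, -1}" "\<And>s. s \<in> interior J \<Longrightarrow> sgn (deriv \<phi> s) = \<sigma>"
    using constant_sign[OF convex_interior[OF is_interval_convex[OF interval]] order_refl] by blast
  obtain s where s: "s \<in> J"
    using interior_nonempty interior_subset by blast
  \<comment> \<open>From time \<open>s\<close> the remaining arc \<open>h - arc (\<phi> s)\<close>
    takes that long, forwards on a rising branch and backwards on a falling one.\<close>
  have "\<bar>t - (s + \<sigma> * (h - arc (\<phi> s)))\<bar> = h - arc (\<phi> t)" if t: "t \<in> J" for t
    using arc_branch[OF order_refl interval \<sigma> s t] \<sigma>(1) arc_le_h[OF t] by auto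
  then show ?thesis
    by blast
qed

text \<open>Applying \<open>F\<close> to \<open>arc (\<phi> t) = h - \<bar>t - c\<bar>\<close>
  recovers \<open>\<phi> t\<close> on the left and gives \<open>Phi c t\<close> on the
  right.\<close>

lemma extension: "\<exists>c. J \<subseteq> {c - h..c + h} \<and> (\<forall>t\<in>J. Phi c t = \<phi> t)"
proof -
  obtain c where c: "\<And>t. t \<in> J \<Longrightarrow> \<bar>t - c\<bar> = h - arc (\<phi> t)"
    using center_exists by blast
  have "t \<in> {c - h..c + h}" "Phi c t = \<phi> t" if t: "t \<in> J" for t
  proof -
    show "t \<in> {c - h..c + h}"
      unfolding mem_profile using c[OF t] arc_le_h[OF t] by simp
    show "Phi c t = \<phi> t"
      using c[OF t] range[OF t] by (simp add: Phi_def F_arc)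
  qed
  then show ?thesis
    by blast
qed

end

theorem theorem3p4:
  fixes n :: nat and K C :: real and \<phi> :: "real \<Rightarrow> real" and J :: "real set"
  assumes "n \<ge> 3" and "K > 0"
    and "is_interval J" and "interior J \<noteq> {}"
    and "radius_function \<phi> J"
    and "ode_solution n K \<phi> J"
    and "integration_constant n K \<phi> J C"
  shows
    "((\<forall>A \<sigma>. A \<subseteq> J \<longrightarrow> is_interval A \<longrightarrow> \<sigma> \<in> {1, -1} \<longrightarrow>
         (\<forall>s\<in>interior A. sgn (deriv \<phi> s) = \<sigma>) \<longrightarrow> inverse_branch n K C \<phi> A \<sigma>) \<and>
      (\<forall>t0\<in>J. \<forall>t\<in>J.
         (\<exists>m p \<sigma>. sign_subdivision \<phi> t0 t m p \<sigma>) \<and>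
         (\<forall>m p \<sigma>. sign_subdivision \<phi> t0 t m p \<sigma> \<longrightarrow>
            t - t0 = piecewise_integral n K C \<phi> m p \<sigma>))) \<and>
     interval_lebesgue_integrable lborel (lower_radius n K C) (upper_radius n K C)
       (integrand n K C) \<and>
     0 < period_T n K C \<and>
     (\<exists>C' \<Phi>. let T = period_T n K C; I = {C'..C' + T};
                I1 = {C'..C' + T / 2}; I2 = {C' + T / 2..C' + T} in
        (J \<subseteq> I \<and> (\<forall>t\<in>J. \<Phi> t = \<phi> t) \<and>
         radius_function \<Phi> I \<and> ode_solution n K \<Phi> I \<and> integration_constant n K \<Phi> I C \<and>
         \<Phi> C' = lower_radius n K C \<and> \<Phi> (C' + T) = lower_radius n K C) \<and>
        ((\<forall>t\<in>interior I1. sgn (deriv \<Phi> t) = 1) \<and> inverse_branch n K C \<Phi> I1 1 \<and>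
         (\<forall>t\<in>interior I2. sgn (deriv \<Phi> t) = -1) \<and> inverse_branch n K C \<Phi> I2 (-1)) \<and>
        (let \<Phi>r = (\<lambda>s. \<Phi> (- s)) in
         (\<forall>s\<in>interior (uminus ` I1). sgn (deriv \<Phi>r s) = -1) \<and>
         inverse_branch n K C \<Phi>r (uminus ` I1) (-1) \<and>
         (\<forall>s\<in>interior (uminus ` I2). sgn (deriv \<Phi>r s) = 1) \<and>
         inverse_branch n K C \<Phi>r (uminus ` I2) 1))"
proof -
  interpret rotation_curve n K C \<phi> J
    using assms by unfold_locales
  obtain c where c: "J \<subseteq> {c - h..c + h}" "\<forall>t\<in>J. Phi c t = \<phi> t"
    using extension by blast
  \<comment> \<open>The initial time \<open>C'\<close> is taken as \<open>c - h\<close>, so the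
    midpoint of \<open>I\<close> is the centre and its right end is \<open>c + h\<close>.\<close>
  have shift: "c - h + period_T n K C / 2 = c" "c - h + period_T n K C = c + h"
    by simp_all
  show ?thesis
  proof (intro conjI)
    show "\<exists>C' \<Phi>. let T = period_T n K C; I = {C'..C' + T};
                I1 = {C'..C' + T / 2}; I2 = {C' + T / 2..C' + T} in
        (J \<subseteq> I \<and> (\<forall>t\<in>J. \<Phi> t = \<phi> t) \<and>
         radius_function \<Phi> I \<and> ode_solution n K \<Phi> I \<and> integration_constant n K \<Phi> I C \<and>
         \<Phi> C' = l \<and> \<Phi> (C' + T) = l) \<and>
        ((\<forall>t\<in>interior I1. sgn (deriv \<Phi> t) = 1) \<and> inverse_branch n K C \<Phi> I1 1 \<and>
         (\<forall>t\<in>interior I2. sgn (deriv \<Phi> t) = -1) \<and> inverse_branch n K C \<Phi> I2 (-1)) \<and>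
        (let \<Phi>r = (\<lambda>s. \<Phi> (- s)) in
         (\<forall>s\<in>interior (uminus ` I1). sgn (deriv \<Phi>r s) = -1) \<and>
         inverse_branch n K C \<Phi>r (uminus ` I1) (-1) \<and>
         (\<forall>s\<in>interior (uminus ` I2). sgn (deriv \<Phi>r s) = 1) \<and>
         inverse_branch n K C \<Phi>r (uminus ` I2) 1)"
      unfolding Let_def
      by (rule exI[of _ "c - h"], rule exI[of _ "Phi c"], unfold shift)
        (intro conjI c Phi_radius_function Phi_ode_solution Phi_integration_constant Phi_ends
          Phi_branches)
  qed (use branch subdivision_exists piecewise_time period_pos
      g_interval_integrable lower_less_upper in auto)
qed

end
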